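(* For $b>0$, $\nu>-1$, $w\in\mathbb C$ and $t\in[-1,1]$, $$\mathscr I_{b,\nu}(w,t)=\frac1{B(b,\nu+1)}\int_0^1u^{b-1}(1-u)^\nu\,\mathcal I_b(uw)\,e^{(1-u)wt}\,du.$$
   Context: For $\nu>-1$, $b>-\nu-1$, $w\in\mathbb C$, $t\in[-1,1]$, $$\mathscr I_{b,\nu}(w,t):=\sum_{m=0}^\infty\frac{\Gamma(b+\nu+1)}{\Gamma(b+\nu+m+1)}\left(\frac w2\right)^m\mathcal I_{b+\nu+m}(w)\,\widetilde C_m^{(\nu)}(t),$$ where $\mathcal I_\mu(w):=\sum_{m=0}^\infty\frac{(w/2)^{2m}}{(\mu+1)_m\,m!}$ is the normalized modified Bessel function ($(a)_m$ is the Pochhammer symbol), and $$\widetilde C_m^{(\nu)}(t):=\frac{m+\nu}{\nu}\sum_{k=0}^{\lfloor m/2\rfloor}(-1)^k\frac{\Gamma(m-k+\nu)}{\Gamma(\nu)\,k!\,(m-2k)!}(2t)^{m-2k}$$ is the normalized Gegenbauer polynomial, interpreted at $\nu=0$ as the limit $\nu\to0$ (so $\widetilde C_0^{(\nu)}=1$ for all $\nu$). $B(\cdot,\cdot)$ is the Beta function. *)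

theory Defs
  imports "HOL-Analysis.Analysis"
begin

definition bessel_I_norm :: "real \<Rightarrow> complex \<Rightarrow> complex" where
  "bessel_I_norm \<mu> w =
     (\<Sum>m. (w / 2) ^ (2 * m) / (pochhammer (complex_of_real (\<mu> + 1)) m * fact m))"

definition gegenbauer_norm_formula :: "real \<Rightarrow> nat \<Rightarrow> real \<Rightarrow> real" where
  "gegenbauer_norm_formula \<nu> m t =
     (real m + \<nu>) / \<nu> *
     (\<Sum>k = 0..m div 2. (-1) ^ k * (Gamma (real (m - k) + \<nu>) / (Gamma \<nu> * fact k * fact (m - 2 * k)))
                         * (2 * t) ^ (m - 2 * k))"

text \<open>The formula has a removable singularity at \<open>\<nu> = 0\<close>, where division by zero would
  otherwise yield the wrong value \<open>0\<close>.\<close>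

definition gegenbauer_norm :: "real \<Rightarrow> nat \<Rightarrow> real \<Rightarrow> real" where
  "gegenbauer_norm \<nu> m t =
     (if \<nu> = 0 then Lim (at 0) (\<lambda>\<nu>'. gegenbauer_norm_formula \<nu>' m t)
      else gegenbauer_norm_formula \<nu> m t)"

definition scrI_term :: "real \<Rightarrow> real \<Rightarrow> complex \<Rightarrow> real \<Rightarrow> nat \<Rightarrow> complex" where
  "scrI_term b \<nu> w t m =
     complex_of_real (Gamma (b + \<nu> + 1) / Gamma (b + \<nu> + real m + 1)) * (w / 2) ^ m *
     bessel_I_norm (b + \<nu> + real m) w * complex_of_real (gegenbauer_norm \<nu> m t)"

definition scrI :: "real \<Rightarrow> real \<Rightarrow> complex \<Rightarrow> real \<Rightarrow> complex" where
  "scrI b \<nu> w t = (\<Sum>m. scrI_term b \<nu> w t m)"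

end

theory Submission
  imports Defs
begin

text \<open>
  Both sides are rearrangements of one absolutely convergent triple series.

  Put \<open>c = b + \<nu> + 1\<close>. Inserting the explicit Gegenbauer sum and the Bessel series into the left-hand
  side, with \<open>n = m - 2k\<close>, gives the terms
  \<open>(-1)\<^sup>k (\<nu> + n + 2k) (\<nu> + 1)\<^bsub>n + k - 1\<^esub> / (n! k! j! (c)\<^bsub>n + 2k + j\<^esub>) (w t)\<^sup>n (w/2)\<^bsup>2(k + j)\<^esup>\<close>
  over all triples \<open>(n, k, j)\<close>. Up to a constant factor they are bounded by the terms
  of a product of three exponential series (\<open>scrI_expansion_summable\<close>), so any grouping has the same sum.

  Grouping by \<open>m = n + 2k\<close> returns the series on the left (\<open>scrI_term_has_sum\<close>). Grouping by \<open>n\<close> and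
  \<open>i = k + j\<close> leaves a finite alternating sum over \<open>k\<close>; it is very well-poised and, by two
  applications of Chu--Vandermonde, equals, apart from the factor \<open>1 / n!\<close>,
  \<open>(b)\<^bsub>2i\<^esub> (\<nu> + 1)\<^sub>n / ((b + 1)\<^sub>i i! (c)\<^bsub>2i + n\<^esub>)\<close> (\<open>sum_gegenbauer_coeff\<close>).

  The quotient \<open>(b)\<^bsub>2i\<^esub> (\<nu> + 1)\<^sub>n / (c)\<^bsub>2i + n\<^esub>\<close> is \<open>B(b + 2i, \<nu> + 1 + n) / B(b, \<nu> + 1)\<close>, which is
  the normalized integral of \<open>u\<^bsup>b - 1 + 2i\<^esup> (1 - u)\<^bsup>\<nu> + n\<^esup>\<close>. Hence the second grouping is the termwise
  integral of the product of the Bessel series at \<open>u w\<close> and the exponential series at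
  \<open>(1 - u) w t\<close> (\<open>integrated_terms_has_sum\<close>). On the unit interval the terms of that
  double series are bounded by multiples of the Beta kernel with summable coefficients, so
  integration and summation commute (\<open>integral_has_sum\<close>).
\<close>

section \<open>Gegenbauer coefficients as polynomials in the parameter\<close>

text \<open>For \<open>n + k > 0\<close> this is \<open>(\<nu> + n + 2k) (\<nu> + 1)\<^bsub>n + k - 1\<^esub>\<close>, the value of
  \<open>(m + \<nu>) \<Gamma>(m - k + \<nu>) / \<Gamma>(\<nu> + 1)\<close> at \<open>m = n + 2k\<close>. Splitting \<open>\<nu> + n + 2k\<close> as
  \<open>(\<nu> + n + k) + k\<close> gives the form below, which also has the right value \<open>1\<close> at \<open>n = k = 0\<close>,
  has no denominator in \<open>\<nu>\<close>, is visibly nonnegative for \<open>\<nu> > -1\<close>, and later splits the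
  connecting sum into two Chu--Vandermonde sums.\<close>
definition gegenbauer_coeff :: "real \<Rightarrow> nat \<Rightarrow> nat \<Rightarrow> real" where
  "gegenbauer_coeff \<nu> n k =
     pochhammer (\<nu> + 1) (n + k) + real k * pochhammer (\<nu> + 1) (n + k - 1)"

lemma gegenbauer_coeff_factored:
  assumes "n + k > 0"
  shows "gegenbauer_coeff \<nu> n k = (\<nu> + real (n + 2 * k)) * pochhammer (\<nu> + 1) (n + k - 1)"
proof -
  obtain l where l: "n + k = Suc l" using assms by (cases "n + k") auto
  have "real n + real k = real l + 1" using l by linarith
  then have "pochhammer (\<nu> + 1) (Suc l) = pochhammer (\<nu> + 1) l * (\<nu> + real n + real k)"
    by (simp add: pochhammer_Suc add.assoc)
  then show ?thesis
    unfolding gegenbauer_coeff_def l by (simp add: algebra_simps)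
qed

definition gegenbauer_poly :: "real \<Rightarrow> nat \<Rightarrow> real \<Rightarrow> real" where
  "gegenbauer_poly \<nu> m t =
     (\<Sum>k\<le>m div 2. (-1) ^ k * gegenbauer_coeff \<nu> (m - 2 * k) k / (fact k * fact (m - 2 * k))
                       * (2 * t) ^ (m - 2 * k))"

lemma gegenbauer_norm_formula_eq_poly:
  assumes "\<nu> > -1" "\<nu> \<noteq> 0"
  shows "gegenbauer_norm_formula \<nu> m t = gegenbauer_poly \<nu> m t"
proof -
  have nz: "Gamma \<nu> \<noteq> 0"
  proof -
    have "\<nu> \<notin> \<int>\<^sub>\<le>\<^sub>0" using assms by (auto elim!: nonpos_Ints_cases)
    then show ?thesis by (simp add: Gamma_eq_zero_iff)
  qed
  have Gam1: "Gamma (\<nu> + 1) = \<nu> * Gamma \<nu>"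
    using assms by (intro Gamma_plus1) (auto elim!: nonpos_Ints_cases)
  show ?thesis
  proof (cases "m = 0")
    case True
    then show ?thesis using nz assms
      by (simp add: gegenbauer_norm_formula_def gegenbauer_poly_def gegenbauer_coeff_def)
  next
    case False
    have "(real m + \<nu>) / \<nu> * ((-1) ^ k * (Gamma (real (m - k) + \<nu>) / (Gamma \<nu> * fact k * fact (m - 2 * k)))
            * (2 * t) ^ (m - 2 * k))
        = (-1) ^ k * gegenbauer_coeff \<nu> (m - 2 * k) k / (fact k * fact (m - 2 * k)) * (2 * t) ^ (m - 2 * k)"
      if "k \<le> m div 2" for k
    proof -
      have k: "2 * k \<le> m" using that by simp
      have mk: "m - 2 * k + k = m - k" "m - 2 * k + 2 * k = m" "m - k > 0" using k False by auto
      have "\<nu> + 1 \<notin> \<int>\<^sub>\<le>\<^sub>0" using assms by (auto elim!: nonpos_Ints_cases)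
      then have "pochhammer (\<nu> + 1) (m - k - 1) = Gamma (\<nu> + 1 + real (m - k - 1)) / Gamma (\<nu> + 1)"
        by (rule pochhammer_Gamma)
      also have "\<nu> + 1 + real (m - k - 1) = real (m - k) + \<nu>" using mk(3) by (simp add: of_nat_diff)
      finally have P: "pochhammer (\<nu> + 1) (m - k - 1) = Gamma (real (m - k) + \<nu>) / (\<nu> * Gamma \<nu>)"
        by (simp add: Gam1)
      have G: "gegenbauer_coeff \<nu> (m - 2 * k) k
          = (\<nu> + real m) * (Gamma (real (m - k) + \<nu>) / (\<nu> * Gamma \<nu>))"
        using gegenbauer_coeff_factored[of "m - 2 * k" k \<nu>] mk(3) unfolding mk(1,2) P by blast
      show ?thesis unfolding G using nz assms(2) by (simp add: field_simps)
    qed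
    then show ?thesis
      unfolding gegenbauer_norm_formula_def gegenbauer_poly_def sum_distrib_left atLeast0AtMost
      by (intro sum.cong) auto
  qed
qed

text \<open>The polynomial form is continuous in \<open>\<nu>\<close>, so it computes the limit that defines the case
  \<open>\<nu> = 0\<close>; from here on no case distinction on \<open>\<nu>\<close> is made.\<close>
lemma gegenbauer_norm_eq_poly:
  assumes "\<nu> > -1"
  shows "gegenbauer_norm \<nu> m t = gegenbauer_poly \<nu> m t"
proof (cases "\<nu> = 0")
  case False
  then show ?thesis using assms by (simp add: gegenbauer_norm_def gegenbauer_norm_formula_eq_poly)
next
  case True
  have "isCont (\<lambda>x. gegenbauer_poly x m t) 0"
    unfolding gegenbauer_poly_def gegenbauer_coeff_def pochhammer_prod by (intro continuous_intros) auto
  then have "((\<lambda>x. gegenbauer_poly x m t) \<longlongrightarrow> gegenbauer_poly 0 m t) (at 0)"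
    by (simp add: isCont_def)
  moreover have "\<forall>\<^sub>F x in at 0. gegenbauer_poly x m t = gegenbauer_norm_formula x m t"
  proof -
    have "\<forall>\<^sub>F x::real in at 0. x > -1"
      by (rule order_tendstoD[OF tendsto_ident_at]) simp
    moreover have "\<forall>\<^sub>F x::real in at 0. x \<noteq> 0" by (rule eventually_neq_at_within)
    ultimately show ?thesis
      by eventually_elim (simp add: gegenbauer_norm_formula_eq_poly)
  qed
  ultimately have "((\<lambda>x. gegenbauer_norm_formula x m t) \<longlongrightarrow> gegenbauer_poly 0 m t) (at 0)"
    by (rule Lim_transform_eventually)
  then show ?thesis
    unfolding gegenbauer_norm_def True by (simp add: tendsto_Lim)
qed

section \<open>The connecting hypergeometric sum\<close>

text \<open>The quotient \<open>(-n)\<^sub>k / k!\<close> in the hypergeometric form of the identity is a signed binomial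
  coefficient.\<close>
lemma Chu_Vandermonde:
  fixes x y :: real
  assumes "y > 0"
  shows "(\<Sum>k\<le>n. (-1) ^ k * real (n choose k) * pochhammer x k / pochhammer y k)
          = pochhammer (y - x) n / pochhammer y n"
proof -
  have "(\<Sum>k=0..n. (pochhammer x k * pochhammer (- real n) k) / (of_nat (fact k) * pochhammer y k))
          = pochhammer (y - x) n / pochhammer y n"
    using assms by (intro Vandermonde_pochhammer) auto
  moreover have "(-1) ^ k * real (n choose k) = pochhammer (- real n) k / fact k" for k
    by (simp add: binomial_gbinomial gbinomial_pochhammer flip: power_add mult_2)
  ultimately show ?thesis
    by (simp add: atLeast0AtMost algebra_simps)
qed

text \<open>Up to the factor \<open>a\<close>, the bracket is the very well-poised factor \<open>(a + 2k) (a)\<^sub>k\<close>. Both of its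
  summands give a Chu--Vandermonde sum, the second one after absorbing \<open>k\<close> into the binomial
  coefficient and shifting the index. The results share the factor \<open>(b + i + 1)\<^bsub>i - 1\<^esub>\<close>, with
  cofactors \<open>b + i\<close> and \<open>-i\<close>, which leaves \<open>b\<close>.\<close>
lemma very_well_poised_sum:
  fixes a b :: real
  assumes "b > 0" "a > -1"
  shows "(\<Sum>k\<le>i. (-1) ^ k * real (i choose k)
            * (pochhammer (a + 1) k + real k * pochhammer (a + 1) (k - 1)) / pochhammer (a + b + 1) (i + k))
          = pochhammer b (2 * i) / (pochhammer (b + 1) i * pochhammer (a + b + 1) (2 * i))"
proof (cases i)
  case 0
  then show ?thesis by simp
next
  case (Suc l)
  define d where "d = a + b + 1 + real i"
  have d: "d > 0" using assms by (simp add: d_def)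
  have split: "pochhammer (a + b + 1) (i + k) = pochhammer (a + b + 1) i * pochhammer d k" for k
    by (simp add: pochhammer_product' d_def)
  have S1: "(\<Sum>k\<le>i. (-1) ^ k * real (i choose k) * pochhammer (a + 1) k / pochhammer d k)
        = pochhammer (b + real i) i / pochhammer d i"
    using Chu_Vandermonde[OF d, where n = i and x = "a + 1"] by (simp add: d_def add_ac)
  have S2: "(\<Sum>k\<le>i. (-1) ^ k * real (i choose k) * (real k * pochhammer (a + 1) (k - 1)) / pochhammer d k)
        = - real i * pochhammer (b + real i + 1) l / pochhammer d i"
  proof -
    have "(\<Sum>k\<le>i. (-1) ^ k * real (i choose k) * (real k * pochhammer (a + 1) (k - 1)) / pochhammer d k)
       = (\<Sum>k\<le>l. (-1) ^ Suc k * real (Suc l choose Suc k) * (real (Suc k) * pochhammer (a + 1) k) / pochhammer d (Suc k))"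
      unfolding Suc sum.atMost_Suc_shift by simp
    also have "\<dots> = (\<Sum>k\<le>l. - real i / d * ((-1) ^ k * real (l choose k) * pochhammer (a + 1) k / pochhammer (d + 1) k))"
    proof (intro sum.cong refl)
      fix k
      have B: "real (Suc l choose Suc k) * real (Suc k) = real i * real (l choose k)"
        using Suc_times_binomial_eq[of l k] Suc by (metis of_nat_mult)
      have "(-1) ^ Suc k * real (Suc l choose Suc k) * (real (Suc k) * pochhammer (a + 1) k) / pochhammer d (Suc k)
        = (-1) ^ Suc k * (real (Suc l choose Suc k) * real (Suc k)) * pochhammer (a + 1) k / (d * pochhammer (d + 1) k)"
        by (simp add: pochhammer_rec)
      also have "\<dots> = - real i / d * ((-1) ^ k * real (l choose k) * pochhammer (a + 1) k / pochhammer (d + 1) k)"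
        unfolding B by simp
      finally show "(-1) ^ Suc k * real (Suc l choose Suc k) * (real (Suc k) * pochhammer (a + 1) k) / pochhammer d (Suc k)
        = - real i / d * ((-1) ^ k * real (l choose k) * pochhammer (a + 1) k / pochhammer (d + 1) k)" .
    qed
    also have "\<dots> = - real i / d * (pochhammer (d + 1 - (a + 1)) l / pochhammer (d + 1) l)"
      unfolding sum_distrib_left[symmetric] by (subst Chu_Vandermonde) (use d in auto)
    also have "d + 1 - (a + 1) = b + real i + 1" by (simp add: d_def)
    also have "- real i / d * (pochhammer (b + real i + 1) l / pochhammer (d + 1) l)
        = - real i * pochhammer (b + real i + 1) l / pochhammer d i"
      by (simp add: Suc pochhammer_rec)
    finally show ?thesis .
  qed
  have nz: "pochhammer (b + 1) i \<noteq> 0" using assms pochhammer_pos[of "b + 1" i] by auto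
  have P: "pochhammer b (2 * i) = b * (pochhammer (b + 1) i * pochhammer (b + real i + 1) l)"
  proof -
    have "2 * i = Suc (i + l)" by (simp add: Suc)
    then have "pochhammer b (2 * i) = b * pochhammer (b + 1) (i + l)"
      by (simp only: pochhammer_rec)
    then show ?thesis by (simp add: pochhammer_product' add_ac)
  qed
  have "(\<Sum>k\<le>i. (-1) ^ k * real (i choose k)
            * (pochhammer (a + 1) k + real k * pochhammer (a + 1) (k - 1)) / pochhammer (a + b + 1) (i + k))
     = ((\<Sum>k\<le>i. (-1) ^ k * real (i choose k) * pochhammer (a + 1) k / pochhammer d k)
       + (\<Sum>k\<le>i. (-1) ^ k * real (i choose k) * (real k * pochhammer (a + 1) (k - 1)) / pochhammer d k))
       / pochhammer (a + b + 1) i"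
    unfolding sum_divide_distrib split sum.distrib[symmetric]
    by (intro sum.cong refl) (simp add: add_divide_distrib distrib_left mult_ac)
  also have "\<dots> = b * pochhammer (b + real i + 1) l / (pochhammer d i * pochhammer (a + b + 1) i)"
  proof -
    have "pochhammer (b + real i) i - real i * pochhammer (b + real i + 1) l = b * pochhammer (b + real i + 1) l"
      by (simp add: Suc pochhammer_rec algebra_simps)
    then show ?thesis unfolding S1 S2
      by (metis (no_types, opaque_lifting) add_divide_distrib diff_conv_add_uminus divide_divide_eq_left mult_minus_left)
  qed
  also have "\<dots> = pochhammer b (2 * i) / (pochhammer (b + 1) i * pochhammer (a + b + 1) (2 * i))"
  proof -
    have "pochhammer (a + b + 1) (2 * i) = pochhammer (a + b + 1) i * pochhammer d i"
      using split[of i] by (simp add: mult_2)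
    then show ?thesis using nz by (simp add: P)
  qed
  finally show ?thesis .
qed

text \<open>Up to the common factor \<open>1 / n!\<close>, this compares the coefficients of
  \<open>(w t)\<^sup>n (w/2)\<^bsup>2i\<^esup>\<close>: on the left those of the
  Gegenbauer--Bessel series, on the right those produced by the Beta integral. It is the very
  well-poised sum at \<open>a = \<nu> + n\<close>, once \<open>(\<nu> + 1)\<^sub>n\<close> and \<open>(b + \<nu> + 1)\<^sub>n\<close> are split off.\<close>
lemma sum_gegenbauer_coeff:
  fixes b \<nu> :: real
  assumes "b > 0" "\<nu> > -1"
  shows "(\<Sum>k\<le>i. (-1) ^ k * gegenbauer_coeff \<nu> n k
            / (fact k * fact (i - k) * pochhammer (b + \<nu> + 1) (n + i + k)))
          = pochhammer b (2 * i) * pochhammer (\<nu> + 1) n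
            / (pochhammer (b + 1) i * fact i * pochhammer (b + \<nu> + 1) (2 * i + n))"
proof -
  define a where "a = \<nu> + real n"
  have a: "a > -1" using assms by (simp add: a_def)
  have num: "gegenbauer_coeff \<nu> n k = pochhammer (\<nu> + 1) n *
     (pochhammer (a + 1) k + real k * pochhammer (a + 1) (k - 1))" for k
  proof (cases k)
    case (Suc l)
    have "pochhammer (\<nu> + 1) (n + l) = pochhammer (\<nu> + 1) n * pochhammer (a + 1) l"
         "pochhammer (\<nu> + 1) (n + k) = pochhammer (\<nu> + 1) n * pochhammer (a + 1) k"
      using pochhammer_product'[of "\<nu> + 1" n l] pochhammer_product'[of "\<nu> + 1" n k]
      by (simp_all add: a_def add_ac)
    then show ?thesis by (simp add: gegenbauer_coeff_def Suc algebra_simps)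
  qed (simp add: gegenbauer_coeff_def)
  have den: "pochhammer (b + \<nu> + 1) (n + l) = pochhammer (b + \<nu> + 1) n * pochhammer (a + b + 1) l" for l
    using pochhammer_product'[of "b + \<nu> + 1" n l] by (simp add: a_def add_ac)
  have "(\<Sum>k\<le>i. (-1) ^ k * gegenbauer_coeff \<nu> n k
            / (fact k * fact (i - k) * pochhammer (b + \<nu> + 1) (n + i + k)))
     = (\<Sum>k\<le>i. pochhammer (\<nu> + 1) n / (fact i * pochhammer (b + \<nu> + 1) n) *
        ((-1) ^ k * real (i choose k)
            * (pochhammer (a + 1) k + real k * pochhammer (a + 1) (k - 1)) / pochhammer (a + b + 1) (i + k)))"
    by (intro sum.cong refl) (simp add: num den[of "i + _", folded add.assoc] binomial_fact mult_ac)
  also have "\<dots> = pochhammer (\<nu> + 1) n / (fact i * pochhammer (b + \<nu> + 1) n) *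
     (pochhammer b (2 * i) / (pochhammer (b + 1) i * pochhammer (a + b + 1) (2 * i)))"
    unfolding sum_distrib_left[symmetric] very_well_poised_sum[OF assms(1) a] ..
  finally show ?thesis using den[of "2 * i"] by (simp add: add.commute mult_ac)
qed

section \<open>Absolute convergence of the fully expanded series\<close>

text \<open>Every factor \<open>x + i\<close> with \<open>i > 0\<close> is at least \<open>1\<close>; only the factor \<open>x\<close> itself can make the
  product smaller.\<close>
lemma pochhammer_almost_mono:
  fixes x :: real
  assumes "x > 0" "m \<le> n"
  shows "min x 1 * pochhammer x m \<le> pochhammer x n"
  using assms(2)
proof (induction n)
  case 0
  then show ?case by simp
next
  case (Suc n)
  have pos: "pochhammer x k > 0" for k using assms(1) by (rule pochhammer_pos)
  consider "m = Suc n" | "m = 0" "n = 0" | "m \<le> n" "n > 0" using Suc.prems by linarith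
  then show ?case
  proof cases
    case 1
    have "min x 1 * pochhammer x m \<le> 1 * pochhammer x m"
      using pos[of m] by (intro mult_right_mono) auto
    then show ?thesis by (simp add: 1)
  next
    case 2
    then show ?thesis by simp
  next
    case 3
    have "min x 1 * pochhammer x m \<le> pochhammer x n * 1" using Suc.IH 3 by simp
    also have "\<dots> \<le> pochhammer x n * (x + real n)"
      using pos[of n] 3 assms(1) by (intro mult_left_mono) auto
    finally show ?thesis by (simp add: pochhammer_Suc)
  qed
qed

lemma pochhammer_mono_base:
  fixes x y :: real
  assumes "0 < x" "x \<le> y"
  shows "pochhammer x n \<le> pochhammer y n"
  unfolding pochhammer_prod using assms by (intro prod_mono) auto

lemma exp_terms_summable_on: "(\<lambda>n. x ^ n / fact n :: real) summable_on UNIV" if "x \<ge> 0"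
  using that summable_exp_generic[of x]
  by (intro summable_nonneg_imp_summable_on) (auto simp: field_simps scaleR_conv_of_real)

lemma exp_terms_has_sum: "((\<lambda>n. z ^ n / fact n) has_sum exp z) UNIV" for z :: complex
proof -
  have "summable (\<lambda>n. norm (z ^ n / fact n))"
    using summable_norm_exp[of z] by (simp add: field_simps scaleR_conv_of_real)
  moreover have "(\<lambda>n. z ^ n / fact n) sums exp z"
    using exp_converges[of z] by (simp add: field_simps scaleR_conv_of_real)
  ultimately show ?thesis by (rule norm_summable_imp_has_sum)
qed

lemma summable_on_product:
  fixes f :: "'a \<Rightarrow> real" and g :: "'b \<Rightarrow> real"
  assumes "f summable_on A" "g summable_on B" "\<And>x. x \<in> A \<Longrightarrow> f x \<ge> 0" "\<And>y. y \<in> B \<Longrightarrow> g y \<ge> 0"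
  shows "(\<lambda>(x, y). f x * g y) summable_on A \<times> B"
proof (rule summable_on_SigmaI)
  show "((\<lambda>y. case (x, y) of (x, y) \<Rightarrow> f x * g y) has_sum f x * infsum g B) B" for x
    using assms(2) by (simp add: has_sum_cmult_right)
  show "(\<lambda>x. f x * infsum g B) summable_on A"
    using assms(1) by (rule summable_on_cmult_left)
qed (use assms in auto)

lemma bessel_I_norm_has_sum:
  assumes "\<mu> > -1"
  shows "((\<lambda>m. (w / 2) ^ (2 * m) / (complex_of_real (pochhammer (\<mu> + 1) m) * fact m))
           has_sum bessel_I_norm \<mu> w) UNIV"
proof -
  define r where "r = (norm w / 2)\<^sup>2"
  define \<kappa> where "\<kappa> = min (\<mu> + 1) 1"
  have \<kappa>: "\<kappa> > 0" using assms by (simp add: \<kappa>_def)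
  have bound: "norm ((w / 2) ^ (2 * m) / (complex_of_real (pochhammer (\<mu> + 1) m) * fact m))
          \<le> (r ^ m / fact m) / \<kappa>" for m
  proof -
    have p: "\<kappa> \<le> pochhammer (\<mu> + 1) m"
      using pochhammer_almost_mono[of "\<mu> + 1" 0 m] assms by (simp add: \<kappa>_def)
    have "norm ((w / 2) ^ (2 * m) / (complex_of_real (pochhammer (\<mu> + 1) m) * fact m))
        = r ^ m / fact m / pochhammer (\<mu> + 1) m"
      using p \<kappa> by (simp add: norm_divide norm_mult norm_power r_def power_mult abs_of_pos)
    also have "\<dots> \<le> (r ^ m / fact m) / \<kappa>"
      using p \<kappa> by (intro divide_left_mono mult_pos_pos) (auto simp: r_def)
    finally show ?thesis .
  qed
  have "r \<ge> 0" by (simp add: r_def)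
  then have "summable (\<lambda>m. r ^ m / fact m / \<kappa>)"
    using exp_terms_summable_on[of r] by (intro summable_divide summable_on_imp_summable)
  then have S: "summable (\<lambda>m. norm ((w / 2) ^ (2 * m) / (complex_of_real (pochhammer (\<mu> + 1) m) * fact m)))"
    by (rule summable_comparison_test'[where N = 0]) (use bound in simp)
  have "(\<lambda>m. (w / 2) ^ (2 * m) / (complex_of_real (pochhammer (\<mu> + 1) m) * fact m)) sums bessel_I_norm \<mu> w"
    using summable_sums[OF summable_norm_cancel[OF S]]
    unfolding bessel_I_norm_def pochhammer_of_real .
  with S show ?thesis by (rule norm_summable_imp_has_sum)
qed

text \<open>Inserting the Gegenbauer sum (index \<open>k\<close>, with \<open>n = m - 2k\<close>) and the Bessel series (index \<open>j\<close>)
  turns the Gamma quotient and the Bessel denominators into the single symbol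
  \<open>(b + \<nu> + 1)\<^bsub>m + j\<^esub>\<close>. Taking \<open>n\<close> instead of \<open>m\<close> as summation index makes the three indices
  independent.\<close>
definition scrI_coeff :: "real \<Rightarrow> real \<Rightarrow> nat \<Rightarrow> nat \<Rightarrow> nat \<Rightarrow> real" where
  "scrI_coeff b \<nu> n k j =
     (-1) ^ k * gegenbauer_coeff \<nu> n k
       / (fact n * fact k * fact j * pochhammer (b + \<nu> + 1) (n + 2 * k + j))"

definition scrI_expansion :: "real \<Rightarrow> real \<Rightarrow> complex \<Rightarrow> real \<Rightarrow> (nat \<times> nat) \<times> nat \<Rightarrow> complex" where
  "scrI_expansion b \<nu> w t = (\<lambda>((n, k), j).
     of_real (scrI_coeff b \<nu> n k j) * (w * of_real t) ^ n * (w / 2) ^ (2 * (k + j)))"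

text \<open>The two Pochhammer symbols in the Gegenbauer coefficient are dominated by the one in the
  denominator, since \<open>\<nu> + 1 \<le> b + \<nu> + 1\<close> and their order is not larger. What remains is the
  factor \<open>1 + k \<le> 2 ^ k\<close>.\<close>
lemma scrI_coeff_bound:
  assumes "b > 0" "\<nu> > -1"
  shows "\<bar>scrI_coeff b \<nu> n k j\<bar>
           \<le> 2 ^ k / (min (b + \<nu> + 1) 1 * (fact n * fact k * fact j))"
proof -
  define c where "c = b + \<nu> + 1"
  define \<kappa> where "\<kappa> = min c 1"
  define P where "P = pochhammer c (n + 2 * k + j)"
  have c: "c > 0" "\<nu> + 1 > 0" "\<nu> + 1 \<le> c" and \<kappa>: "\<kappa> > 0" using assms by (auto simp: c_def \<kappa>_def)
  have P: "P > 0" unfolding P_def using c by (intro pochhammer_pos)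
  have le: "\<kappa> * pochhammer (\<nu> + 1) m \<le> P" if "m \<le> n + 2 * k + j" for m
  proof -
    have "\<kappa> * pochhammer (\<nu> + 1) m \<le> \<kappa> * pochhammer c m"
      using c \<kappa> by (intro mult_left_mono pochhammer_mono_base) auto
    also have "\<dots> \<le> P"
      unfolding \<kappa>_def P_def using c(1) that by (rule pochhammer_almost_mono)
    finally show ?thesis .
  qed
  have pos: "pochhammer (\<nu> + 1) m > 0" for m using c by (intro pochhammer_pos)
  have "gegenbauer_coeff \<nu> n k \<ge> 0"
    unfolding gegenbauer_coeff_def using pos by (intro add_nonneg_nonneg mult_nonneg_nonneg) (auto intro: less_imp_le)
  then have "\<bar>scrI_coeff b \<nu> n k j\<bar> = (gegenbauer_coeff \<nu> n k / P) / (fact n * fact k * fact j)"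
    using P unfolding scrI_coeff_def P_def c_def[symmetric]
    by (simp add: abs_mult power_abs)
  also have "gegenbauer_coeff \<nu> n k / P \<le> 2 ^ k / \<kappa>"
  proof -
    have "\<kappa> * gegenbauer_coeff \<nu> n k
        = \<kappa> * pochhammer (\<nu> + 1) (n + k) + real k * (\<kappa> * pochhammer (\<nu> + 1) (n + k - 1))"
      by (simp add: gegenbauer_coeff_def algebra_simps)
    also have "\<dots> \<le> P + real k * P"
      using le[of "n + k"] le[of "n + k - 1"] by (intro add_mono mult_left_mono) auto
    also have "\<dots> = (1 + real k) * P" by (simp add: algebra_simps)
    also have "\<dots> \<le> 2 ^ k * P"
    proof (intro mult_right_mono)
      have "Suc k \<le> 2 ^ k" by (simp add: Suc_leI)
      then show "1 + real k \<le> 2 ^ k" by (metis of_nat_Suc of_nat_le_iff of_nat_numeral of_nat_power add.commute)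
    qed (use P in auto)
    finally show ?thesis using P \<kappa> by (simp add: field_simps)
  qed
  finally show ?thesis by (simp add: \<kappa>_def c_def divide_right_mono)
qed

text \<open>By the coefficient bound, a constant multiple of a product of three exponential series is a
  majorant; the factor \<open>2 ^ k\<close> goes into the argument of the second one.\<close>
lemma scrI_expansion_summable:
  assumes "b > 0" "\<nu> > -1" "\<bar>t\<bar> \<le> 1"
  shows "scrI_expansion b \<nu> w t summable_on UNIV"
proof -
  define r where "r = (norm w / 2)\<^sup>2"
  define \<kappa> where "\<kappa> = min (b + \<nu> + 1) 1"
  define g where "g = (\<lambda>((n, k), j). ((norm w ^ n / fact n) * ((2 * r) ^ k / fact k)) * (r ^ j / fact j))"
  have r: "r \<ge> 0" by (simp add: r_def)
  have \<kappa>: "\<kappa> > 0" using assms by (simp add: \<kappa>_def)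
  have "(\<lambda>(n, k). (norm w ^ n / fact n) * ((2 * r) ^ k / fact k)) summable_on UNIV \<times> UNIV"
    by (intro summable_on_product exp_terms_summable_on) (use r in auto)
  then have "(\<lambda>(p, j). (case p of (n, k) \<Rightarrow> (norm w ^ n / fact n) * ((2 * r) ^ k / fact k)) * (r ^ j / fact j))
      summable_on (UNIV \<times> UNIV) \<times> UNIV"
    by (intro summable_on_product exp_terms_summable_on) (use r in auto)
  then have "g summable_on UNIV" by (simp add: g_def case_prod_unfold)
  then have "(\<lambda>p. g p / \<kappa>) summable_on UNIV"
    using summable_on_cmult_left[of g UNIV "1 / \<kappa>"] by simp
  moreover have "norm (scrI_expansion b \<nu> w t p) \<le> g p / \<kappa>" for p
  proof -
    obtain n k j where p: "p = ((n, k), j)" by (metis prod.exhaust)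
    have "norm (scrI_expansion b \<nu> w t p)
        = \<bar>scrI_coeff b \<nu> n k j\<bar> * (norm w * \<bar>t\<bar>) ^ n * r ^ (k + j)"
      by (simp add: p scrI_expansion_def norm_mult norm_power norm_divide r_def flip: power_mult)
    also have "\<dots> \<le> 2 ^ k / (\<kappa> * (fact n * fact k * fact j)) * norm w ^ n * r ^ (k + j)"
    proof (intro mult_mono)
      show "(norm w * \<bar>t\<bar>) ^ n \<le> norm w ^ n"
        using assms(3) by (intro power_mono) (auto simp: mult_left_le)
    qed (use scrI_coeff_bound[OF assms(1,2)] r \<kappa> in \<open>auto simp: \<kappa>_def\<close>)
    also have "\<dots> = g p / \<kappa>"
      by (simp add: p g_def power_add power_mult_distrib field_simps)
    finally show ?thesis .
  qed
  ultimately have "(\<lambda>p. norm (scrI_expansion b \<nu> w t p)) summable_on UNIV"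
    by (rule Infinite_Sum.abs_summable_on_comparison_test')
  then show ?thesis by (rule abs_summable_summable)
qed

section \<open>Two groupings of the expanded series\<close>

text \<open>Collecting the terms with the same \<open>m = n + 2k\<close> undoes the expansion: the sum over \<open>j\<close> is the
  Bessel function and the finite sum over \<open>k\<close> is the Gegenbauer polynomial.\<close>
lemma scrI_term_has_sum:
  assumes "b > 0" "\<nu> > -1" and S: "(scrI_expansion b \<nu> w t has_sum S) UNIV"
  shows "(scrI_term b \<nu> w t has_sum S) UNIV"
proof -
  define q where "q = (\<lambda>m k. complex_of_real
     ((-1) ^ k * gegenbauer_coeff \<nu> (m - 2 * k) k / (fact k * fact (m - 2 * k)) * (2 * t) ^ (m - 2 * k)))"
  define p where "p = (\<lambda>m. complex_of_real (Gamma (b + \<nu> + 1) / Gamma (b + \<nu> + real m + 1))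
     * (w / 2) ^ m * bessel_I_norm (b + \<nu> + real m) w)"
  have "((\<lambda>((m, k), j). scrI_expansion b \<nu> w t ((m - 2 * k, k), j)) has_sum S)
          ((SIGMA m:UNIV. {..m div 2}) \<times> UNIV)"
    using S
    by (subst has_sum_reindex_bij_witness[where T = UNIV and h = "scrI_expansion b \<nu> w t"
          and j = "\<lambda>((m, k), j). ((m - 2 * k, k), j)" and i = "\<lambda>((n, k), j). ((n + 2 * k, k), j)"]) auto
  then have "((\<lambda>(m, k). p m * q m k) has_sum S) (SIGMA m:UNIV. {..m div 2})"
  proof (rule has_sum_SigmaD)
    fix mk :: "nat \<times> nat" assume "mk \<in> (SIGMA m:UNIV. {..m div 2})"
    then obtain m k where mk: "mk = (m, k)" "2 * k \<le> m" by auto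
    define n where "n = m - 2 * k"
    have m: "m = n + 2 * k" using mk by (simp add: n_def)
    have c: "b + \<nu> + 1 > 0" using assms by simp
    have G: "Gamma (b + \<nu> + 1) / Gamma (b + \<nu> + real m + 1) = 1 / pochhammer (b + \<nu> + 1) m"
    proof -
      have "b + \<nu> + 1 \<notin> \<int>\<^sub>\<le>\<^sub>0" using c by (auto elim!: nonpos_Ints_cases)
      from pochhammer_Gamma[OF this, of m] show ?thesis by (simp add: add_ac)
    qed
    have eq: "scrI_expansion b \<nu> w t ((n, k), j) =
        of_real (Gamma (b + \<nu> + 1) / Gamma (b + \<nu> + real m + 1)) * (w / 2) ^ m * q m k *
        ((w / 2) ^ (2 * j) / (complex_of_real (pochhammer (b + \<nu> + real m + 1) j) * fact j))" for j
    proof -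
      have d: "pochhammer (b + \<nu> + 1) (m + j) = pochhammer (b + \<nu> + 1) m * pochhammer (b + \<nu> + real m + 1) j"
        using pochhammer_product'[of "b + \<nu> + 1" m j] by (simp add: add_ac)
      have "(w * of_real t) ^ n * (w / 2) ^ (2 * (k + j))
          = (w / 2) ^ m * (2 * of_real t) ^ n * (w / 2) ^ (2 * j)"
        unfolding m by (simp add: power_add power_mult_distrib power_divide distrib_left)
      then have "scrI_expansion b \<nu> w t ((n, k), j)
          = of_real (scrI_coeff b \<nu> n k j) * ((w / 2) ^ m * (2 * of_real t) ^ n * (w / 2) ^ (2 * j))"
        by (simp add: scrI_expansion_def mult.assoc)
      then show ?thesis
        unfolding G q_def scrI_coeff_def m[symmetric] d n_def[symmetric] by (simp add: mult_ac)
    qed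
    have "((\<lambda>j. (w / 2) ^ (2 * j) / (complex_of_real (pochhammer (b + \<nu> + real m + 1) j) * fact j))
        has_sum bessel_I_norm (b + \<nu> + real m) w) UNIV"
      using assms by (intro bessel_I_norm_has_sum) auto
    from has_sum_cmult_right[OF this]
    have "((\<lambda>j. scrI_expansion b \<nu> w t ((n, k), j)) has_sum
        of_real (Gamma (b + \<nu> + 1) / Gamma (b + \<nu> + real m + 1)) * (w / 2) ^ m * q m k
          * bessel_I_norm (b + \<nu> + real m) w) UNIV"
      unfolding eq .
    moreover have "of_real (Gamma (b + \<nu> + 1) / Gamma (b + \<nu> + real m + 1)) * (w / 2) ^ m * q m k
          * bessel_I_norm (b + \<nu> + real m) w = p m * q m k"
      by (simp add: p_def)
    ultimately show "((\<lambda>j. (\<lambda>((m, k), j). scrI_expansion b \<nu> w t ((m - 2 * k, k), j)) (mk, j))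
            has_sum (case mk of (m, k) \<Rightarrow> p m * q m k)) UNIV"
      by (simp only: mk(1) prod.case n_def)
  qed
  then show ?thesis
  proof (rule has_sum_SigmaD)
    fix m
    have "scrI_term b \<nu> w t m = (\<Sum>k\<le>m div 2. p m * q m k)"
      unfolding scrI_term_def gegenbauer_norm_eq_poly[OF assms(2)] gegenbauer_poly_def p_def q_def
      by (simp add: sum_distrib_left)
    then show "((\<lambda>k. case (m, k) of (m, k) \<Rightarrow> p m * q m k) has_sum scrI_term b \<nu> w t m) {..m div 2}"
      by (simp add: has_sum_finite_iff)
  qed
qed

text \<open>The coefficient of \<open>u\<^bsup>2i\<^esup> (1 - u)\<^sup>n\<close> in the product of the exponential and the Bessel series of
  the integrand.\<close>
definition exp_bessel_coeff :: "real \<Rightarrow> complex \<Rightarrow> real \<Rightarrow> nat \<times> nat \<Rightarrow> complex" where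
  "exp_bessel_coeff b w t = (\<lambda>(n, i).
     (w * of_real t) ^ n / fact n * ((w / 2) ^ (2 * i) / (of_real (pochhammer (b + 1) i) * fact i)))"

lemma Beta_shift:
  fixes a b :: real
  assumes "a > 0" "b > 0"
  shows "Beta (a + real k) (b + real n)
           = Beta a b * (pochhammer a k * pochhammer b n / pochhammer (a + b) (k + n))"
proof -
  have G: "Gamma (x + real m) = pochhammer x m * Gamma x" if "x > 0" for x :: real and m
  proof -
    have "x \<notin> \<int>\<^sub>\<le>\<^sub>0" using that by (auto elim!: nonpos_Ints_cases)
    moreover have "Gamma x \<noteq> 0" using Gamma_real_pos[OF that] by simp
    ultimately show ?thesis by (simp add: pochhammer_Gamma)
  qed
  have "a + real k + (b + real n) = a + b + real (k + n)" by simp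
  then show ?thesis
    unfolding Beta_def using assms by (simp only: G add_pos_pos) (simp add: mult_ac)
qed

text \<open>Collecting instead the terms with the same \<open>n\<close> and \<open>i = k + j\<close> leaves finite sums over \<open>k\<close>, which
  the connecting identity evaluates. The Pochhammer quotient that comes out is the ratio of a
  shifted Beta value to \<open>B(b, \<nu> + 1)\<close>, that is, an integrated term of the right-hand side.\<close>
lemma integrated_terms_has_sum:
  assumes "b > 0" "\<nu> > -1" and S: "(scrI_expansion b \<nu> w t has_sum S) UNIV"
  shows "((\<lambda>(n, i). exp_bessel_coeff b w t (n, i) * of_real (Beta (b + real (2 * i)) (\<nu> + 1 + real n)))
            has_sum of_real (Beta b (\<nu> + 1)) * S) UNIV"
proof -
  have "((\<lambda>((n, i), k). scrI_expansion b \<nu> w t ((n, k), i - k)) has_sum S) (SIGMA p:UNIV. {..snd p})"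
    using S
    by (subst has_sum_reindex_bij_witness[where T = UNIV and h = "scrI_expansion b \<nu> w t"
          and j = "\<lambda>((n, i), k). ((n, k), i - k)" and i = "\<lambda>((n, k), j). ((n, k + j), k)"]) auto
  then have "((\<lambda>(n, i). exp_bessel_coeff b w t (n, i) *
        of_real (pochhammer b (2 * i) * pochhammer (\<nu> + 1) n / pochhammer (b + \<nu> + 1) (2 * i + n)))
      has_sum S) UNIV"
  proof (rule has_sum_SigmaD)
    fix p :: "nat \<times> nat"
    obtain n i where p: "p = (n, i)" by (cases p)
    have "(\<Sum>k\<le>i. scrI_expansion b \<nu> w t ((n, k), i - k))
        = (\<Sum>k\<le>i. of_real ((-1) ^ k * gegenbauer_coeff \<nu> n k
              / (fact k * fact (i - k) * pochhammer (b + \<nu> + 1) (n + i + k)))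
            * ((w * of_real t) ^ n / fact n * (w / 2) ^ (2 * i)))"
    proof (intro sum.cong refl)
      fix k assume "k \<in> {..i}"
      then have exponents: "n + 2 * k + (i - k) = n + i + k" "k + (i - k) = i" by auto
      show "scrI_expansion b \<nu> w t ((n, k), i - k) = of_real ((-1) ^ k * gegenbauer_coeff \<nu> n k
              / (fact k * fact (i - k) * pochhammer (b + \<nu> + 1) (n + i + k)))
            * ((w * of_real t) ^ n / fact n * (w / 2) ^ (2 * i))"
        unfolding scrI_expansion_def scrI_coeff_def prod.case exponents by (simp add: mult_ac)
    qed
    also have "\<dots> = of_real (pochhammer b (2 * i) * pochhammer (\<nu> + 1) n
            / (pochhammer (b + 1) i * fact i * pochhammer (b + \<nu> + 1) (2 * i + n)))
            * ((w * of_real t) ^ n / fact n * (w / 2) ^ (2 * i))"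
      unfolding sum_distrib_right[symmetric] of_real_sum[symmetric] sum_gegenbauer_coeff[OF assms(1,2)] ..
    finally show "((\<lambda>k. (\<lambda>((n, i), k). scrI_expansion b \<nu> w t ((n, k), i - k)) (p, k)) has_sum
        (case p of (n, i) \<Rightarrow> exp_bessel_coeff b w t (n, i) *
        of_real (pochhammer b (2 * i) * pochhammer (\<nu> + 1) n / pochhammer (b + \<nu> + 1) (2 * i + n)))) {..snd p}"
      by (simp add: p has_sum_finite_iff exp_bessel_coeff_def mult_ac)
  qed
  from has_sum_cmult_right[OF this, of "of_real (Beta b (\<nu> + 1))"]
  have "((\<lambda>(n, i). of_real (Beta b (\<nu> + 1)) * (exp_bessel_coeff b w t (n, i) *
        of_real (pochhammer b (2 * i) * pochhammer (\<nu> + 1) n / pochhammer (b + \<nu> + 1) (2 * i + n))))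
      has_sum of_real (Beta b (\<nu> + 1)) * S) UNIV"
    by (simp only: case_prod_unfold)
  moreover have "of_real (Beta b (\<nu> + 1)) * (exp_bessel_coeff b w t (n, i) *
        of_real (pochhammer b (2 * i) * pochhammer (\<nu> + 1) n / pochhammer (b + \<nu> + 1) (2 * i + n)))
      = exp_bessel_coeff b w t (n, i) * of_real (Beta (b + real (2 * i)) (\<nu> + 1 + real n))" for n i
  proof -
    have "Beta (b + real (2 * i)) (\<nu> + 1 + real n) = Beta b (\<nu> + 1) *
        (pochhammer b (2 * i) * pochhammer (\<nu> + 1) n / pochhammer (b + \<nu> + 1) (2 * i + n))"
      using Beta_shift[of b "\<nu> + 1" "2 * i" n] assms(1,2) by (simp only: add.assoc)
    then show ?thesis by (simp only: of_real_mult mult_ac)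
  qed
  ultimately show ?thesis by simp
qed

section \<open>Termwise integration\<close>

text \<open>The kernel is nonnegative, so the gauge integral of the Beta function theory is an absolutely
  convergent Lebesgue integral.\<close>
lemma Beta_kernel_integral:
  fixes a b :: real
  assumes "a > 0" "b > 0"
  shows "set_integrable lborel {0..1} (\<lambda>u. u powr (a - 1) * (1 - u) powr (b - 1))"
    and "(LINT u:{0..1}|lborel. u powr (a - 1) * (1 - u) powr (b - 1)) = Beta a b"
proof -
  let ?k = "\<lambda>u. u powr (a - 1) * (1 - u) powr (b - 1)"
  have I: "(?k has_integral Beta a b) {0..1}"
    using assms by (rule has_integral_Beta_real)
  then have "?k absolutely_integrable_on {0..1}"
    by (intro nonnegative_absolutely_integrable_1) auto
  then show int: "set_integrable lborel {0..1} ?k"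
    unfolding set_integrable_def by (subst (asm) integrable_completion) auto
  show "(LINT u:{0..1}|lborel. ?k u) = Beta a b"
    using set_borel_integral_eq_integral(2)[OF int] I by (simp add: integral_unique)
qed

text \<open>Dominated convergence for series indexed by pairs, reduced to sequences by an enumeration of the
  index set.\<close>
lemma integral_has_sum:
  fixes F :: "nat \<times> nat \<Rightarrow> 'a \<Rightarrow> complex"
  assumes int: "\<And>p. integrable M (F p)"
    and norm: "\<And>x. (\<lambda>p. norm (F p x)) summable_on UNIV"
    and norm_int: "(\<lambda>p. \<integral>x. norm (F p x) \<partial>M) summable_on UNIV"
    and sum: "\<And>x. ((\<lambda>p. F p x) has_sum f x) UNIV"
  shows "integrable M f" and "((\<lambda>p. integral\<^sup>L M (F p)) has_sum integral\<^sup>L M f) UNIV"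
proof -
  define G where "G = (\<lambda>l. F (prod_decode l))"
  have summable: "summable (\<lambda>l. g (prod_decode l))" if "g summable_on UNIV" for g :: "nat \<times> nat \<Rightarrow> real"
    using that summable_on_reindex_bij_betw[OF bij_prod_decode, of g] by (intro summable_on_imp_summable) simp
  have G_int: "integrable M (G l)" for l using int by (simp add: G_def)
  have G_norm: "AE x in M. summable (\<lambda>l. norm (G l x))"
    using summable[OF norm] by (simp add: G_def)
  have G_norm_int: "summable (\<lambda>l. \<integral>x. norm (G l x) \<partial>M)"
    using summable[OF norm_int] by (simp add: G_def)
  have f: "(\<Sum>l. G l x) = f x" for x
  proof -
    have "((\<lambda>l. G l x) has_sum f x) UNIV"
      unfolding G_def using sum has_sum_reindex_bij_betw[OF bij_prod_decode, of "\<lambda>p. F p x"] by simp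
    then show ?thesis by (intro sums_unique[symmetric] has_sum_imp_sums)
  qed
  show "integrable M f"
    using integrable_suminf[OF G_int G_norm G_norm_int] by (simp add: f)
  have "(\<lambda>l. integral\<^sup>L M (G l)) sums integral\<^sup>L M f"
    using sums_integral[OF G_int G_norm G_norm_int] by (simp add: f)
  moreover have "summable (\<lambda>l. norm (integral\<^sup>L M (G l)))"
    by (rule summable_comparison_test'[OF G_norm_int, of 0]) (simp add: integral_norm_bound)
  ultimately have "((\<lambda>l. integral\<^sup>L M (G l)) has_sum integral\<^sup>L M f) UNIV"
    by (intro norm_summable_imp_has_sum)
  then show "((\<lambda>p. integral\<^sup>L M (F p)) has_sum integral\<^sup>L M f) UNIV"
    unfolding G_def using has_sum_reindex_bij_betw[OF bij_prod_decode, of "\<lambda>p. integral\<^sup>L M (F p)"] by simp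
qed

lemma exp_bessel_coeff_norm_summable:
  assumes "b > 0"
  shows "(\<lambda>p. norm (exp_bessel_coeff b w t p)) summable_on UNIV"
proof -
  define r where "r = (norm w / 2)\<^sup>2"
  define g where "g = (\<lambda>(n, i). (norm w * \<bar>t\<bar>) ^ n / fact n * (r ^ i / fact i))"
  have "(\<lambda>(n, i). (norm w * \<bar>t\<bar>) ^ n / fact n * (r ^ i / fact i)) summable_on UNIV \<times> UNIV"
    by (intro summable_on_product exp_terms_summable_on) (auto simp: r_def)
  then have "g summable_on UNIV" by (simp add: g_def)
  then show ?thesis
  proof (rule Infinite_Sum.abs_summable_on_comparison_test')
    fix p :: "nat \<times> nat"
    obtain n i where p: "p = (n, i)" by (cases p)
    have P: "1 \<le> pochhammer (b + 1) i"
      using pochhammer_almost_mono[of "b + 1" 0 i] assms by simp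
    have "norm (exp_bessel_coeff b w t p) = (norm w * \<bar>t\<bar>) ^ n / fact n * (r ^ i / (pochhammer (b + 1) i * fact i))"
      using P by (simp add: p exp_bessel_coeff_def norm_mult norm_divide norm_power r_def flip: power_mult)
    also have "\<dots> \<le> (norm w * \<bar>t\<bar>) ^ n / fact n * (r ^ i / (1 * fact i))"
      using P by (intro mult_left_mono divide_left_mono mult_right_mono) (auto simp: r_def)
    finally show "norm (exp_bessel_coeff b w t p) \<le> g p" by (simp add: p g_def)
  qed
qed

lemma exp_bessel_has_sum:
  assumes "b > 0"
  shows "((\<lambda>(n, i). exp_bessel_coeff b w t (n, i) * of_real (u ^ (2 * i) * (1 - u) ^ n)) has_sum
            bessel_I_norm b (of_real u * w) * exp (of_real (1 - u) * w * of_real t)) UNIV"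
proof -
  define x where "x = of_real (1 - u) * w * of_real t"
  define p where "p = (\<lambda>n. x ^ n / fact n)"
  define q where "q = (\<lambda>i. (of_real u * w / 2) ^ (2 * i) / (complex_of_real (pochhammer (b + 1) i) * fact i))"
  have P: "(p has_sum exp x) UNIV" unfolding p_def by (rule exp_terms_has_sum)
  have Q: "(q has_sum bessel_I_norm b (of_real u * w)) UNIV"
    unfolding q_def using assms by (intro bessel_I_norm_has_sum) simp
  have eq: "exp_bessel_coeff b w t (n, i) * of_real (u ^ (2 * i) * (1 - u) ^ n) = p n * q i" for n i
    by (simp add: exp_bessel_coeff_def p_def q_def x_def power_mult_distrib power_divide)
  have "(\<lambda>z. norm ((\<lambda>(n, i). p n * q i) z)) summable_on UNIV \<times> UNIV"
  proof -
    have "(\<lambda>n. norm (p n)) summable_on UNIV" "(\<lambda>i. norm (q i)) summable_on UNIV"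
      using P Q by (auto simp: summable_on_iff_abs_summable_on_complex[symmetric] intro: has_sum_imp_summable)
    from summable_on_product[OF this] show ?thesis by (simp add: case_prod_unfold norm_mult)
  qed
  then have "(\<lambda>(n, i). p n * q i) summable_on UNIV \<times> UNIV" by (rule abs_summable_summable)
  then have "((\<lambda>(n, i). p n * q i) has_sum exp x * bessel_I_norm b (of_real u * w)) (UNIV \<times> UNIV)"
    by (rule has_sum_SigmaI[rotated 2])
       (use has_sum_cmult_right[OF Q] has_sum_cmult_left[OF P] in auto)
  then show ?thesis unfolding eq x_def[symmetric] by (simp add: mult.commute)
qed

section \<open>The integral representation\<close>
theorem proposition2p6p3:
  fixes b \<nu> t :: real and w :: complex
  assumes "b > 0" and "\<nu> > -1" and "t \<in> {-1..1}"
  defines "f \<equiv> \<lambda>u::real. complex_of_real (u powr (b - 1) * (1 - u) powr \<nu>) *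
                 bessel_I_norm b (complex_of_real u * w) *
                 exp (complex_of_real (1 - u) * w * complex_of_real t)"
  shows "summable (scrI_term b \<nu> w t) \<and>
         set_integrable lborel {0..1} f \<and>
         scrI b \<nu> w t = 1 / complex_of_real (Beta b (\<nu> + 1)) * (LINT u:{0..1}|lborel. f u)"
proof -
  define S where "S = infsum (scrI_expansion b \<nu> w t) UNIV"
  have "(scrI_expansion b \<nu> w t has_sum S) UNIV"
    unfolding S_def using assms by (intro has_sum_infsum scrI_expansion_summable) auto
  then have scrI: "(scrI_term b \<nu> w t has_sum S) UNIV"
    and double: "((\<lambda>(n, i). exp_bessel_coeff b w t (n, i) * of_real (Beta (b + real (2 * i)) (\<nu> + 1 + real n)))
            has_sum of_real (Beta b (\<nu> + 1)) * S) UNIV"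
    using scrI_term_has_sum[OF assms(1,2)] integrated_terms_has_sum[OF assms(1,2)] by blast+
  have sums: "scrI_term b \<nu> w t sums S" using scrI by (rule has_sum_imp_sums)

  (* The kernel of the (n, i)-th Beta integral. It is bounded by the kernel at (0, 0), which
     therefore dominates all terms at once. *)
  define \<phi> :: "nat \<times> nat \<Rightarrow> real \<Rightarrow> real" where
    "\<phi> = (\<lambda>(n, i) u. indicator {0..1} u * (u powr (b + real (2 * i) - 1) * (1 - u) powr (\<nu> + 1 + real n - 1)))"
  have \<phi>_eq: "\<phi> (n, i) u = \<phi> (0, 0) u * (u ^ (2 * i) * (1 - u) ^ n)" for n i u
  proof (cases "0 < u \<and> u < 1")
    case True
    then have "u powr (b + real (2 * i) - 1) = u powr (b - 1) * u ^ (2 * i)"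
        "(1 - u) powr (\<nu> + 1 + real n - 1) = (1 - u) powr \<nu> * (1 - u) ^ n"
      by (simp_all add: powr_add powr_diff powr_realpow[symmetric] del: of_nat_mult)
    then show ?thesis by (simp add: \<phi>_def)
    (* At the endpoints both sides are 0, because 0 powr x = 0 for every x. *)
  qed (auto simp: \<phi>_def indicator_def)
  have \<phi>_nonneg: "\<phi> p u \<ge> 0" for p u by (cases p) (simp add: \<phi>_def)
  have \<phi>_le: "\<phi> p u \<le> \<phi> (0, 0) u" for p u
  proof (cases "u \<in> {0..1}")
    case True
    obtain n i where p: "p = (n, i)" by (cases p)
    have "u ^ (2 * i) * (1 - u) ^ n \<le> 1"
      using True by (intro mult_le_one power_le_one) auto
    then show ?thesis unfolding p \<phi>_eq[of n i] using \<phi>_nonneg by (rule mult_left_le)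
  qed (cases p, simp add: \<phi>_def)
  have \<phi>_int: "integrable lborel (\<phi> (n, i))"
      "integral\<^sup>L lborel (\<phi> (n, i)) = Beta (b + real (2 * i)) (\<nu> + 1 + real n)" for n i
    using Beta_kernel_integral[of "b + real (2 * i)" "\<nu> + 1 + real n"] assms(1,2)
    by (simp_all add: set_integrable_def set_lebesgue_integral_def \<phi>_def)
  have \<phi>_int': "integrable lborel (\<phi> p)" for p by (cases p) (simp add: \<phi>_int)

  define F where "F = (\<lambda>p u. exp_bessel_coeff b w t p * of_real (\<phi> p u))"
  define f' where "f' = (\<lambda>u. indicator {0..1} u *\<^sub>R f u)"
  have norm_F: "norm (F p u) = norm (exp_bessel_coeff b w t p) * \<phi> p u" for p u
    using \<phi>_nonneg[of p u] by (simp add: F_def norm_mult)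
  have F_int: "integrable lborel (F p)" for p
    unfolding F_def using \<phi>_int'[of p] by simp
  have F_norm: "(\<lambda>p. norm (F p u)) summable_on UNIV" for u
  proof (rule summable_on_comparison_test)
    show "(\<lambda>p. norm (exp_bessel_coeff b w t p) * \<phi> (0, 0) u) summable_on UNIV"
      using exp_bessel_coeff_norm_summable[OF assms(1)] by (rule summable_on_cmult_left)
    show "norm (F p u) \<le> norm (exp_bessel_coeff b w t p) * \<phi> (0, 0) u" for p
      unfolding norm_F by (intro mult_left_mono \<phi>_le) simp
  qed simp
  have F_norm_int: "(\<lambda>p. LINT u|lborel. norm (F p u)) summable_on UNIV"
  proof (rule summable_on_comparison_test)
    show "(\<lambda>p. norm (exp_bessel_coeff b w t p) * integral\<^sup>L lborel (\<phi> (0, 0))) summable_on UNIV"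
      using exp_bessel_coeff_norm_summable[OF assms(1)] by (rule summable_on_cmult_left)
    show "(LINT u|lborel. norm (F p u)) \<le> norm (exp_bessel_coeff b w t p) * integral\<^sup>L lborel (\<phi> (0, 0))" for p
      unfolding norm_F integral_mult_right_zero
      by (intro mult_left_mono integral_mono \<phi>_le \<phi>_int') simp
  qed simp
  have F_sum: "((\<lambda>p. F p u) has_sum f' u) UNIV" for u
  proof -
    have "F p u = (case p of (n, i) \<Rightarrow> exp_bessel_coeff b w t (n, i) * of_real (u ^ (2 * i) * (1 - u) ^ n))
            * of_real (\<phi> (0, 0) u)" for p
    proof -
      obtain n i where "p = (n, i)" by (cases p)
      then show ?thesis by (simp add: F_def \<phi>_eq[of n i u] mult_ac)
    qed
    moreover have "f' u = bessel_I_norm b (of_real u * w) * exp (of_real (1 - u) * w * of_real t)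
            * of_real (\<phi> (0, 0) u)"
      by (simp add: f'_def f_def \<phi>_def scaleR_conv_of_real indicator_def mult_ac)
    ultimately show ?thesis
      using has_sum_cmult_left[OF exp_bessel_has_sum[OF assms(1)]] by simp
  qed
  have "integral\<^sup>L lborel (F p) =
      (case p of (n, i) \<Rightarrow> exp_bessel_coeff b w t (n, i) * of_real (Beta (b + real (2 * i)) (\<nu> + 1 + real n)))" for p
    unfolding F_def by (cases p) (simp add: \<phi>_int)
  then have "((\<lambda>p. integral\<^sup>L lborel (F p)) has_sum of_real (Beta b (\<nu> + 1)) * S) UNIV"
    using double by (simp only:)
  then have "integral\<^sup>L lborel f' = of_real (Beta b (\<nu> + 1)) * S"
    using integral_has_sum(2)[OF F_int F_norm F_norm_int F_sum] by (rule has_sum_unique[rotated])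
  moreover have "integrable lborel f'"
    by (rule integral_has_sum(1)[OF F_int F_norm F_norm_int F_sum])
  moreover have "Beta b (\<nu> + 1) \<noteq> 0"
    using assms(1,2) by (simp add: Beta_def Gamma_real_pos less_imp_neq[symmetric])
  ultimately show ?thesis
    using sums unfolding scrI_def f'_def set_integrable_def set_lebesgue_integral_def
    by (simp add: sums_iff)
qed

end
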